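(* Let $S$ be a monoid and let $A$ be a torsion free quasi-injective $S$-act in the category $\mathrm{Act}_0$-$S$. Then the following conditions are equivalent: (i) $A$ is Dedekind-finite. (ii) $A$ is co-Hopfian. (iii) $A$ is mono-uniform. (iv) Injective endomorphisms of $A$ map essential subacts to essential subacts. (v) Any essential fully invariant subact of $A$ is co-Hopfian. (vi) Any essential fully invariant subact of $A$ is Dedekind-finite.
   Context: $S$-acts are unitary right acts over the monoid $S$. $\mathrm{Act}_0$-$S$ is the category of $S$-acts with a zero element $\theta$ (that is, $\theta s=\theta$ for all $s\in S$), with $S$-homomorphisms preserving this zero; subacts in this category contain $\theta$, and $\Theta=\{\theta\}$ is the one-element act. The coproduct in $\mathrm{Act}_0$-$S$ is $A_1\coprod A_2=A_1\cup A_2$ with $A_1\cap A_2=\Theta$ (the disjoint union with zeros identified). All acts, homomorphisms and subacts here are in $\mathrm{Act}_0$-$S$. Definitions for an $S$-act $A$: - $A$ is torsion free if for all $s\in S$ and $a,b\in A$, $as=bs$ implies $a=b$. - $A$ is quasi-injective if for every subact $B$ of $A$, every homomorphism $f:B\to A$ extends to an endomorphism $h:A\to A$ with $h|_B=f$. - $A$ is Dedekind-finite if $B=\Theta$ is the only $S$-act $B$ (up to isomorphism) with $A\coprod B\cong A$. - $A$ is co-Hopfian if every injective endomorphism of $A$ is an automorphism. - A subact $B$ of $A$ is essential (large), written $B\subseteq' A$, if every $S$-homomorphism $g:A\to C$ whose restriction $g|_B$ is injective is itself injective. - $A$ is mono-uniform if $f(A)\subseteq' A$ for every injective endomorphism $f:A\to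 A$. - A subact $B$ of $A$ is fully invariant if $f(B)\subseteq B$ for every endomorphism $f$ of $A$. *)

theory Defs
  imports "HOL-Algebra.Group"
begin

text \<open>
  Acts over a monoid \<open>S\<close> are carrier based, so that subacts are acts again
  (\<open>A\<lparr>carrier := B\<rparr>\<close>). The zero of an act is part of the structure: an act may have other
  fixed points, and homomorphisms are required to preserve the distinguished one.
\<close>

record ('a, 's) sact = "'a partial_object" +
  act :: "'a \<Rightarrow> 's \<Rightarrow> 'a" (infixl \<open>\<cdot>\<index>\<close> 70)
  theta :: 'a (\<open>\<theta>\<index>\<close>)

definition is_act :: "('s, 'm) monoid_scheme \<Rightarrow> ('a, 's) sact \<Rightarrow> bool" where
  "is_act S A \<longleftrightarrow>
     (\<forall>a \<in> carrier A. \<forall>s \<in> carrier S. a \<cdot>\<^bsub>A\<^esub> s \<in> carrier A) \<and>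
     (\<forall>a \<in> carrier A. \<forall>s \<in> carrier S. \<forall>t \<in> carrier S.
        a \<cdot>\<^bsub>A\<^esub> (s \<otimes>\<^bsub>S\<^esub> t) = (a \<cdot>\<^bsub>A\<^esub> s) \<cdot>\<^bsub>A\<^esub> t) \<and>
     (\<forall>a \<in> carrier A. a \<cdot>\<^bsub>A\<^esub> \<one>\<^bsub>S\<^esub> = a) \<and>
     \<theta>\<^bsub>A\<^esub> \<in> carrier A \<and>
     (\<forall>s \<in> carrier S. \<theta>\<^bsub>A\<^esub> \<cdot>\<^bsub>A\<^esub> s = \<theta>\<^bsub>A\<^esub>)"

definition act_hom ::
  "('s, 'm) monoid_scheme \<Rightarrow> ('a, 's) sact \<Rightarrow> ('b, 's) sact \<Rightarrow> ('a \<Rightarrow> 'b) set" where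
  "act_hom S A B = {f. f \<in> carrier A \<rightarrow> carrier B \<and>
     (\<forall>a \<in> carrier A. \<forall>s \<in> carrier S. f (a \<cdot>\<^bsub>A\<^esub> s) = f a \<cdot>\<^bsub>B\<^esub> s) \<and>
     f \<theta>\<^bsub>A\<^esub> = \<theta>\<^bsub>B\<^esub>}"

definition act_iso ::
  "('s, 'm) monoid_scheme \<Rightarrow> ('a, 's) sact \<Rightarrow> ('b, 's) sact \<Rightarrow> ('a \<Rightarrow> 'b) set" where
  "act_iso S A B = {f \<in> act_hom S A B. bij_betw f (carrier A) (carrier B)}"

definition act_isomorphic ::
  "('s, 'm) monoid_scheme \<Rightarrow> ('a, 's) sact \<Rightarrow> ('b, 's) sact \<Rightarrow> bool" where
  "act_isomorphic S A B \<longleftrightarrow> act_iso S A B \<noteq> {}"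

definition subact :: "('s, 'm) monoid_scheme \<Rightarrow> 'a set \<Rightarrow> ('a, 's) sact \<Rightarrow> bool" where
  "subact S B A \<longleftrightarrow> B \<subseteq> carrier A \<and> \<theta>\<^bsub>A\<^esub> \<in> B \<and>
     (\<forall>b \<in> B. \<forall>s \<in> carrier S. b \<cdot>\<^bsub>A\<^esub> s \<in> B)"

definition zero_act :: "(unit, 's) sact" (\<open>\<Theta>\<close>) where
  "\<Theta> = \<lparr>carrier = {()}, act = (\<lambda>_ _. ()), theta = ()\<rparr>"

text \<open>
  The disjoint union with the two zeros identified: the common zero is \<open>Inl \<theta>\<^bsub>A\<^esub>\<close>, and
  \<open>coprod_inr A B\<close> is the canonical injection of the second summand.
\<close>

definition coprod_inr :: "('a, 's) sact \<Rightarrow> ('b, 's) sact \<Rightarrow> 'b \<Rightarrow> 'a + 'b" where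
  "coprod_inr A B b = (if b = \<theta>\<^bsub>B\<^esub> then Inl \<theta>\<^bsub>A\<^esub> else Inr b)"

definition act_coprod ::
  "('a, 's) sact \<Rightarrow> ('b, 's) sact \<Rightarrow> ('a + 'b, 's) sact" (infixr \<open>\<Coprod>\<close> 65) where
  "A \<Coprod> B =
     \<lparr>carrier = Inl ` carrier A \<union> coprod_inr A B ` carrier B,
      act = (\<lambda>x s. case x of Inl a \<Rightarrow> Inl (a \<cdot>\<^bsub>A\<^esub> s) | Inr b \<Rightarrow> coprod_inr A B (b \<cdot>\<^bsub>B\<^esub> s)),
      theta = Inl \<theta>\<^bsub>A\<^esub>\<rparr>"

definition torsion_free :: "('s, 'm) monoid_scheme \<Rightarrow> ('a, 's) sact \<Rightarrow> bool" where
  "torsion_free S A \<longleftrightarrow> (\<forall>s \<in> carrier S. \<forall>a \<in> carrier A. \<forall>b \<in> carrier A.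
     a \<cdot>\<^bsub>A\<^esub> s = b \<cdot>\<^bsub>A\<^esub> s \<longrightarrow> a = b)"

definition quasi_injective :: "('s, 'm) monoid_scheme \<Rightarrow> ('a, 's) sact \<Rightarrow> bool" where
  "quasi_injective S A \<longleftrightarrow> (\<forall>B. subact S B A \<longrightarrow>
     (\<forall>f \<in> act_hom S (A\<lparr>carrier := B\<rparr>) A. \<exists>h \<in> act_hom S A A. \<forall>b \<in> B. h b = f b))"

definition co_hopfian :: "('s, 'm) monoid_scheme \<Rightarrow> ('a, 's) sact \<Rightarrow> bool" where
  "co_hopfian S A \<longleftrightarrow>
     (\<forall>f \<in> act_hom S A A. inj_on f (carrier A) \<longrightarrow> f \<in> act_iso S A A)"

text \<open>
  In the next two definitions the quantified act lives on the type of \<open>A\<close>. This is no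
  restriction: \<open>dedekind_finiteD\<close> and \<open>essentialD\<close> below give the defining property for acts
  on an arbitrary type.
\<close>

definition dedekind_finite :: "('s, 'm) monoid_scheme \<Rightarrow> ('a, 's) sact \<Rightarrow> bool" where
  "dedekind_finite S A \<longleftrightarrow> (\<forall>B :: ('a, 's) sact.
     is_act S B \<and> act_isomorphic S (A \<Coprod> B) A \<longrightarrow> act_isomorphic S B \<Theta>)"

definition essential :: "('s, 'm) monoid_scheme \<Rightarrow> 'a set \<Rightarrow> ('a, 's) sact \<Rightarrow> bool" where
  "essential S B A \<longleftrightarrow> subact S B A \<and> (\<forall>C :: ('a, 's) sact. is_act S C \<longrightarrow>
     (\<forall>g \<in> act_hom S A C. inj_on g B \<longrightarrow> inj_on g (carrier A)))"

definition mono_uniform :: "('s, 'm) monoid_scheme \<Rightarrow> ('a, 's) sact \<Rightarrow> bool" where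
  "mono_uniform S A \<longleftrightarrow>
     (\<forall>f \<in> act_hom S A A. inj_on f (carrier A) \<longrightarrow> essential S (f ` carrier A) A)"

definition fully_invariant :: "('s, 'm) monoid_scheme \<Rightarrow> 'a set \<Rightarrow> ('a, 's) sact \<Rightarrow> bool" where
  "fully_invariant S B A \<longleftrightarrow> subact S B A \<and> (\<forall>f \<in> act_hom S A A. f ` B \<subseteq> B)"

lemma subact_is_act:
  assumes "is_act S A" and "subact S B A"
  shows "is_act S (A\<lparr>carrier := B\<rparr>)"
  using assms unfolding is_act_def subact_def by (auto simp: subset_iff)

lemma coprod_is_act:
  assumes "monoid S" and "is_act S A" and "is_act S B"
  shows "is_act S (A \<Coprod> B)"
  using assms unfolding is_act_def act_coprod_def coprod_inr_def
  by (auto simp: monoid.m_closed)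

lemma essentialD:
  fixes A :: "('a, 's) sact" and C :: "('c, 's) sact"
  assumes S: "monoid S" and A: "is_act S A" and C: "is_act S C"
    and ess: "essential S B A" and g: "g \<in> act_hom S A C" and inj: "inj_on g B"
  shows "inj_on g (carrier A)"
proof -
  define r where "r = inv_into (carrier A) g"
  have gr: "g (r (g x)) = g x" and rA: "r (g x) \<in> carrier A" if "x \<in> carrier A" for x
    using that by (auto simp: r_def f_inv_into_f inv_into_into)
  have gh: "g (x \<cdot>\<^bsub>A\<^esub> s) = g x \<cdot>\<^bsub>C\<^esub> s" and clA: "x \<cdot>\<^bsub>A\<^esub> s \<in> carrier A"
    if "x \<in> carrier A" "s \<in> carrier S" for x s
    using that g A by (auto simp: act_hom_def is_act_def)
  have gt: "g \<theta>\<^bsub>A\<^esub> = \<theta>\<^bsub>C\<^esub>" and tA: "\<theta>\<^bsub>A\<^esub> \<in> carrier A"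
    using g A by (auto simp: act_hom_def is_act_def)
  define D :: "('a, 's) sact" where
    "D = \<lparr>carrier = (\<lambda>x. r (g x)) ` carrier A, act = (\<lambda>x s. r (g (x \<cdot>\<^bsub>A\<^esub> s))), theta = r (g \<theta>\<^bsub>A\<^esub>)\<rparr>"
  have key: "g (r (g x) \<cdot>\<^bsub>A\<^esub> s) = g (x \<cdot>\<^bsub>A\<^esub> s)" if "x \<in> carrier A" "s \<in> carrier S" for x s
    using that by (simp add: gh rA gr)
  have D: "is_act S D"
    using A S tA unfolding is_act_def D_def
    by (auto simp: key clA monoid.m_closed)
  have h: "(\<lambda>x. r (g x)) \<in> act_hom S A D"
    unfolding act_hom_def D_def by (auto simp: key)
  have BA: "B \<subseteq> carrier A" using ess by (auto simp: essential_def subact_def)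
  have "inj_on (\<lambda>x. r (g x)) B"
  proof (rule inj_onI)
    fix x y assume "x \<in> B" "y \<in> B" "r (g x) = r (g y)"
    then show "x = y" using gr BA inj by (metis inj_onD subsetD)
  qed
  with ess D h have "inj_on (\<lambda>x. r (g x)) (carrier A)" by (auto simp: essential_def)
  then show ?thesis by (auto simp: inj_on_def)
qed

lemma dedekind_finiteD:
  fixes A :: "('a, 's) sact" and B :: "('b, 's) sact"
  assumes S: "monoid S" and A: "is_act S A" and B: "is_act S B"
    and df: "dedekind_finite S A" and iso: "act_isomorphic S (A \<Coprod> B) A"
  shows "act_isomorphic S B \<Theta>"
proof -
  obtain f where f: "f \<in> act_hom S (A \<Coprod> B) A"
    and bij: "bij_betw f (carrier (A \<Coprod> B)) (carrier A)"
    using iso by (auto simp: act_isomorphic_def act_iso_def)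
  define j where "j = (\<lambda>b. f (coprod_inr A B b))"
  have inC: "coprod_inr A B b \<in> carrier (A \<Coprod> B)" if "b \<in> carrier B" for b
    using that by (auto simp: act_coprod_def)
  have inj_inr: "inj_on (coprod_inr A B) (carrier B)"
    by (auto simp: inj_on_def coprod_inr_def split: if_splits)
  have injf: "inj_on f (carrier (A \<Coprod> B))" using bij by (simp add: bij_betw_def)
  have injj: "inj_on j (carrier B)"
    using inj_inr injf inC by (auto simp: inj_on_def j_def)
  have inr_act: "coprod_inr A B b \<cdot>\<^bsub>A \<Coprod> B\<^esub> s = coprod_inr A B (b \<cdot>\<^bsub>B\<^esub> s)"
    if "s \<in> carrier S" for b s
    using that A B by (auto simp: act_coprod_def coprod_inr_def is_act_def)
  have jA: "j b \<in> carrier A" if "b \<in> carrier B" for b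
    using that inC f by (auto simp: j_def act_hom_def)
  have fh: "f (x \<cdot>\<^bsub>A \<Coprod> B\<^esub> s) = f x \<cdot>\<^bsub>A\<^esub> s"
    if "x \<in> carrier (A \<Coprod> B)" "s \<in> carrier S" for x s
    using that f by (auto simp: act_hom_def)
  have jh: "j b \<cdot>\<^bsub>A\<^esub> s = j (b \<cdot>\<^bsub>B\<^esub> s)" if "b \<in> carrier B" "s \<in> carrier S" for b s
    using that by (simp add: j_def fh[symmetric] inC inr_act)
  have jt: "j \<theta>\<^bsub>B\<^esub> = \<theta>\<^bsub>A\<^esub>"
    using f by (auto simp: j_def act_hom_def coprod_inr_def act_coprod_def)
  have clB: "b \<cdot>\<^bsub>B\<^esub> s \<in> carrier B" if "b \<in> carrier B" "s \<in> carrier S" for b s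
    using that B by (auto simp: is_act_def)
  have tB: "\<theta>\<^bsub>B\<^esub> \<in> carrier B" using B by (auto simp: is_act_def)
  define D where "D = A\<lparr>carrier := j ` carrier B\<rparr>"
  have "subact S (j ` carrier B) A"
    using jA jh jt tB clB unfolding subact_def by (auto intro: rev_image_eqI)
  then have D: "is_act S D" unfolding D_def by (rule subact_is_act[OF A])
  have Dsel: "carrier D = j ` carrier B" "act D = act A" "theta D = theta A"
    by (simp_all add: D_def)
  define k where "k = inv_into (carrier B) j"
  have kj: "k (j b) = b" if "b \<in> carrier B" for b
    using that injj by (simp add: k_def)
  have jeq: "j b = \<theta>\<^bsub>A\<^esub> \<longleftrightarrow> b = \<theta>\<^bsub>B\<^esub>" if "b \<in> carrier B" for b
    using that injj jt tB by (metis inj_onD)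
  define p where "p = (\<lambda>x. case x of Inl a \<Rightarrow> f (Inl a) | Inr d \<Rightarrow> f (coprod_inr A B (k d)))"
  have pinr: "p (coprod_inr A D (j b)) = j b" if "b \<in> carrier B" for b
    using that jeq[OF that] kj[OF that] jt
    by (auto simp: p_def coprod_inr_def j_def Dsel)
  have fin: "f (Inl a \<cdot>\<^bsub>A \<Coprod> B\<^esub> s) = f (Inl a) \<cdot>\<^bsub>A\<^esub> s" if "a \<in> carrier A" "s \<in> carrier S" for a s
    by (rule fh) (use that in \<open>simp_all add: act_coprod_def\<close>)
  have inr_actD: "coprod_inr A D d \<cdot>\<^bsub>A \<Coprod> D\<^esub> s = coprod_inr A D (d \<cdot>\<^bsub>D\<^esub> s)"
    if "s \<in> carrier S" for d s
    using that A D by (auto simp: act_coprod_def coprod_inr_def is_act_def)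
  have carD: "carrier (A \<Coprod> D) = Inl ` carrier A \<union> coprod_inr A D ` j ` carrier B"
    and carB: "carrier (A \<Coprod> B) = Inl ` carrier A \<union> coprod_inr A B ` carrier B"
    by (simp_all add: act_coprod_def Dsel)
  have jp: "f (coprod_inr A B b) = j b" for b by (simp add: j_def)
  have pl: "p (Inl a) = f (Inl a)" for a by (simp add: p_def)
  have "p \<in> act_hom S (A \<Coprod> D) A"
  proof -
    have 1: "p \<in> carrier (A \<Coprod> D) \<rightarrow> carrier A"
      using f by (auto simp: carD pinr jA pl act_hom_def carB)
    have 2: "p (x \<cdot>\<^bsub>A \<Coprod> D\<^esub> s) = p x \<cdot>\<^bsub>A\<^esub> s" if "x \<in> carrier (A \<Coprod> D)" "s \<in> carrier S" for x s
      using that(1) unfolding carD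
    proof (elim UnE imageE)
      fix a assume "x = Inl a" "a \<in> carrier A"
      then show ?thesis using fin[of a s] that(2) by (simp add: pl act_coprod_def)
    next
      fix d b assume *: "x = coprod_inr A D d" "d = j b" "b \<in> carrier B"
      then have "p (x \<cdot>\<^bsub>A \<Coprod> D\<^esub> s) = p (coprod_inr A D (j (b \<cdot>\<^bsub>B\<^esub> s)))"
        using that(2) by (simp add: inr_actD jh Dsel)
      then show ?thesis using * that(2) by (simp add: pinr clB jh)
    qed
    have 3: "p \<theta>\<^bsub>A \<Coprod> D\<^esub> = \<theta>\<^bsub>A\<^esub>"
      using f by (simp add: act_coprod_def pl act_hom_def)
    show ?thesis using 1 2 3 by (simp add: act_hom_def)
  qed
  moreover have "bij_betw p (carrier (A \<Coprod> D)) (carrier A)"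
  proof -
    have "p ` carrier (A \<Coprod> D) = f ` carrier (A \<Coprod> B)"
      unfolding carD carB image_Un image_image by (simp add: pl pinr jp cong: image_cong)
    moreover have "inj_on p (carrier (A \<Coprod> D))"
    proof -
      define q where "q = (\<lambda>x. case x of Inl a \<Rightarrow> Inl a | Inr d \<Rightarrow> coprod_inr A B (k d))"
      have pq: "p = f \<circ> q" by (auto simp: p_def q_def fun_eq_iff split: sum.split)
      have qinr: "q (coprod_inr A D (j b)) = coprod_inr A B b" if "b \<in> carrier B" for b
        using jeq[OF that] kj[OF that] by (auto simp: q_def coprod_inr_def Dsel)
      have "inj_on q (carrier (A \<Coprod> D))"
      proof (rule inj_on_inverseI)
        define q' where "q' = (\<lambda>x. case x of Inl a \<Rightarrow> Inl a | Inr b \<Rightarrow> coprod_inr A D (j b))"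
        have "q' (coprod_inr A B b) = coprod_inr A D (j b)" for b
          using jt by (auto simp: q'_def coprod_inr_def Dsel)
        moreover have "q (Inl a) = Inl a" "q' (Inl a) = Inl a" for a
          by (simp_all add: q_def q'_def)
        ultimately show "q' (q x) = x" if "x \<in> carrier (A \<Coprod> D)" for x
          using that unfolding carD by (auto simp: qinr)
      qed
      moreover have "q ` carrier (A \<Coprod> D) \<subseteq> carrier (A \<Coprod> B)"
        unfolding carD carB by (auto simp: qinr) (auto simp: q_def)
      ultimately show ?thesis unfolding pq using injf by (metis comp_inj_on inj_on_subset)
    qed
    ultimately show ?thesis using bij by (simp add: bij_betw_def)
  qed
  ultimately have "act_isomorphic S (A \<Coprod> D) A"
    by (auto simp: act_isomorphic_def act_iso_def)
  with df D have "act_isomorphic S D \<Theta>" by (auto simp: dedekind_finite_def)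
  then obtain u where "bij_betw u (j ` carrier B) {()}"
    by (auto simp: act_isomorphic_def act_iso_def zero_act_def Dsel)
  then have "bij_betw (u \<circ> j) (carrier B) {()}"
    by (rule bij_betw_trans[OF inj_on_imp_bij_betw[OF injj]])
  then have "u \<circ> j \<in> act_iso S B \<Theta>"
    by (auto simp: act_iso_def act_hom_def zero_act_def)
  then show ?thesis by (auto simp: act_isomorphic_def)
qed

end

(* The key point is that the image of an injective endomorphism f of A is a direct summand:
   quasi-injectivity gives a left inverse h of f, and if a s lies in the image then
   f (h a) s = f (h (a s)) = a s, so a = f (h a) lies in the image by torsion freeness.
   Hence the image and its complement (with the zero added) decompose A as a coproduct. *)
theory Submission
  imports Defs
begin

section \<open>Elementary facts on acts, homomorphisms and subacts\<close>

lemma act_hom_closed: "f \<in> act_hom S A B \<Longrightarrow> a \<in> carrier A \<Longrightarrow> f a \<in> carrier B"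
  by (auto simp: act_hom_def)

lemma act_hom_act:
  "f \<in> act_hom S A B \<Longrightarrow> a \<in> carrier A \<Longrightarrow> s \<in> carrier S \<Longrightarrow> f (a \<cdot>\<^bsub>A\<^esub> s) = f a \<cdot>\<^bsub>B\<^esub> s"
  by (auto simp: act_hom_def)

lemma act_hom_theta: "f \<in> act_hom S A B \<Longrightarrow> f \<theta>\<^bsub>A\<^esub> = \<theta>\<^bsub>B\<^esub>"
  by (auto simp: act_hom_def)

lemma act_hom_comp:
  "f \<in> act_hom S A B \<Longrightarrow> g \<in> act_hom S B C \<Longrightarrow> (\<lambda>x. g (f x)) \<in> act_hom S A C"
  by (auto simp: act_hom_def)

lemma act_closed: "is_act S A \<Longrightarrow> a \<in> carrier A \<Longrightarrow> s \<in> carrier S \<Longrightarrow> a \<cdot>\<^bsub>A\<^esub> s \<in> carrier A"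
  by (auto simp: is_act_def)

lemma theta_closed: "is_act S A \<Longrightarrow> \<theta>\<^bsub>A\<^esub> \<in> carrier A"
  by (auto simp: is_act_def)

lemma theta_act: "is_act S A \<Longrightarrow> s \<in> carrier S \<Longrightarrow> \<theta>\<^bsub>A\<^esub> \<cdot>\<^bsub>A\<^esub> s = \<theta>\<^bsub>A\<^esub>"
  by (auto simp: is_act_def)

lemma co_hopfian_surj:
  "co_hopfian S A \<Longrightarrow> f \<in> act_hom S A A \<Longrightarrow> inj_on f (carrier A) \<Longrightarrow> f ` carrier A = carrier A"
  by (auto simp: co_hopfian_def act_iso_def bij_betw_def)

lemma subact_carrier: "is_act S A \<Longrightarrow> subact S (carrier A) A"
  by (auto simp: is_act_def subact_def)

lemma essential_carrier: "is_act S A \<Longrightarrow> essential S (carrier A) A"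
  by (simp add: essential_def subact_carrier)

lemma fully_invariant_carrier: "is_act S A \<Longrightarrow> fully_invariant S (carrier A) A"
  by (auto simp: fully_invariant_def subact_carrier act_hom_def)

lemma subact_image:
  assumes f: "f \<in> act_hom S A C" and B: "subact S B A"
  shows "subact S (f ` B) C"
  unfolding subact_def
proof (intro conjI ballI)
  show "f ` B \<subseteq> carrier C" using assms by (auto simp: subact_def act_hom_def)
  show "\<theta>\<^bsub>C\<^esub> \<in> f ` B"
    using act_hom_theta[OF f] B unfolding subact_def by (metis imageI)
  fix c s assume "c \<in> f ` B" and s: "s \<in> carrier S"
  then obtain b where b: "b \<in> B" "c = f b" by auto
  then have "c \<cdot>\<^bsub>C\<^esub> s = f (b \<cdot>\<^bsub>A\<^esub> s)"
    using s f B by (auto simp: act_hom_act[OF f] subact_def)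
  then show "c \<cdot>\<^bsub>C\<^esub> s \<in> f ` B" using b s B by (auto simp: subact_def)
qed

section \<open>Splitting off the image of an injective endomorphism\<close>

lemma inv_into_act_hom:
  assumes A: "is_act S A" and f: "f \<in> act_hom S A C" and inj: "inj_on f (carrier A)"
  shows "inv_into (carrier A) f \<in> act_hom S (C\<lparr>carrier := f ` carrier A\<rparr>) A"
proof -
  let ?k = "inv_into (carrier A) f"
  have k: "?k (f a) = a" if "a \<in> carrier A" for a using that inj by simp
  have "?k (f a \<cdot>\<^bsub>C\<^esub> s) = a \<cdot>\<^bsub>A\<^esub> s" if "a \<in> carrier A" "s \<in> carrier S" for a s
    using that k[of "a \<cdot>\<^bsub>A\<^esub> s"] by (simp add: act_hom_act[OF f] act_closed[OF A])
  moreover have "?k \<theta>\<^bsub>C\<^esub> = \<theta>\<^bsub>A\<^esub>"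
    using k[OF theta_closed[OF A]] by (simp add: act_hom_theta[OF f])
  ultimately show ?thesis by (auto simp: act_hom_def k)
qed

lemma quasi_injective_left_inverse:
  assumes A: "is_act S A" and q: "quasi_injective S A"
    and f: "f \<in> act_hom S A A" and inj: "inj_on f (carrier A)"
  obtains h where "h \<in> act_hom S A A" "\<And>a. a \<in> carrier A \<Longrightarrow> h (f a) = a"
proof -
  have "subact S (f ` carrier A) A"
    by (rule subact_image[OF f subact_carrier[OF A]])
  with q inv_into_act_hom[OF A f inj]
  obtain h where "h \<in> act_hom S A A" "\<forall>b \<in> f ` carrier A. h b = inv_into (carrier A) f b"
    unfolding quasi_injective_def by blast
  then show ?thesis using inj by (intro that) auto
qed

text \<open>The zero has to be put back because it lies in the image of every endomorphism. Closure
  under the action is proved contrapositively: a translate that falls into the image forces the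
  element itself into the image.\<close>

lemma subact_image_complement:
  assumes A: "is_act S A" and tf: "torsion_free S A"
    and f: "f \<in> act_hom S A A" and h: "h \<in> act_hom S A A"
    and hf: "\<And>a. a \<in> carrier A \<Longrightarrow> h (f a) = a"
  shows "subact S (insert \<theta>\<^bsub>A\<^esub> (carrier A - f ` carrier A)) A"
proof -
  have "a \<in> f ` carrier A"
    if a: "a \<in> carrier A" and s: "s \<in> carrier S" and as: "a \<cdot>\<^bsub>A\<^esub> s \<in> f ` carrier A" for a s
  proof -
    have ha: "h a \<in> carrier A" by (rule act_hom_closed[OF h a])
    have "f (h a) \<cdot>\<^bsub>A\<^esub> s = f (h (a \<cdot>\<^bsub>A\<^esub> s))"
      using a s ha by (simp add: act_hom_act[OF f] act_hom_act[OF h])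
    also have "\<dots> = a \<cdot>\<^bsub>A\<^esub> s" using as hf by auto
    finally have "f (h a) = a"
      using tf a s act_hom_closed[OF f ha] unfolding torsion_free_def by blast
    then show ?thesis using ha by (metis imageI)
  qed
  then show ?thesis
    using A by (auto simp: subact_def theta_closed theta_act act_closed)
qed

lemma act_coprod_image_complement:
  assumes A: "is_act S A" and f: "f \<in> act_hom S A A" and inj: "inj_on f (carrier A)"
    and B: "B = insert \<theta>\<^bsub>A\<^esub> (carrier A - f ` carrier A)"
  shows "act_isomorphic S (A \<Coprod> A\<lparr>carrier := B\<rparr>) A"
proof -
  let ?D = "A\<lparr>carrier := B\<rparr>"
  \<comment> \<open>The isomorphism is \<open>f\<close> on the left summand and the inclusion on the
    right one. The two agree on the common zero because \<open>f\<close> fixes it, so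
    \<open>p\<close> undoes \<open>coprod_inr\<close> on every \<open>b\<close>, zero or
    not.\<close>
  define p where "p = case_sum f (\<lambda>b. b)"
  have ft: "f \<theta>\<^bsub>A\<^esub> = \<theta>\<^bsub>A\<^esub>" by (rule act_hom_theta[OF f])
  have pl: "p (Inl a) = f a" for a by (simp add: p_def)
  have pr: "p (coprod_inr A ?D b) = b" for b
    by (simp add: p_def coprod_inr_def ft)
  \<comment> \<open>The zero lies in the image of \<open>f\<close>, so it is absent from the set
    difference; its copy in \<open>B\<close> is absorbed by the left summand.\<close>
  have car: "carrier (A \<Coprod> ?D) = Inl ` carrier A \<union> Inr ` (carrier A - f ` carrier A)"
  proof -
    have "\<theta>\<^bsub>A\<^esub> \<in> f ` carrier A" using imageI[OF theta_closed[OF A], of f] by (simp only: ft)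
    then show ?thesis
      using theta_closed[OF A] by (auto simp: act_coprod_def coprod_inr_def B image_iff)
  qed
  have "p \<in> act_hom S (A \<Coprod> ?D) A"
    unfolding act_hom_def
  proof (intro CollectI conjI ballI)
    show "p \<in> carrier (A \<Coprod> ?D) \<rightarrow> carrier A"
      unfolding car p_def using act_hom_closed[OF f] by fastforce
    show "p \<theta>\<^bsub>A \<Coprod> ?D\<^esub> = \<theta>\<^bsub>A\<^esub>" by (simp add: act_coprod_def pl ft)
    fix x s assume x: "x \<in> carrier (A \<Coprod> ?D)" and s: "s \<in> carrier S"
    show "p (x \<cdot>\<^bsub>A \<Coprod> ?D\<^esub> s) = p x \<cdot>\<^bsub>A\<^esub> s"
    proof (cases x)
      case (Inl a)
      then have a: "a \<in> carrier A" using x by (auto simp: car)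
      have "Inl a \<cdot>\<^bsub>A \<Coprod> ?D\<^esub> s = Inl (a \<cdot>\<^bsub>A\<^esub> s)" by (simp add: act_coprod_def)
      then show ?thesis using Inl a s by (simp add: pl act_hom_act[OF f])
    next
      case (Inr b)
      have "Inr b \<cdot>\<^bsub>A \<Coprod> ?D\<^esub> s = coprod_inr A ?D (b \<cdot>\<^bsub>A\<^esub> s)" by (simp add: act_coprod_def)
      moreover have "p (Inr b) = b" by (simp add: p_def)
      ultimately show ?thesis using Inr by (simp add: pr)
    qed
  qed
  \<comment> \<open>The two halves of \<open>p\<close> take values in the image of \<open>f\<close>
    and in its complement. These are disjoint and together exhaust \<open>carrier A\<close>, which
    gives injectivity here and surjectivity next.\<close>
  moreover have "inj_on p (carrier (A \<Coprod> ?D))"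
    unfolding car p_def using inj by (fastforce simp: inj_on_def)
  moreover have "p ` carrier (A \<Coprod> ?D) = carrier A"
    unfolding car image_Un image_image p_def using act_hom_closed[OF f] by auto
  ultimately show ?thesis by (auto simp: act_isomorphic_def act_iso_def bij_betw_def)
qed

section \<open>Dedekind-finiteness and co-Hopficity\<close>

lemma act_isomorphic_zero_act_iff:
  assumes "is_act S B"
  shows "act_isomorphic S B \<Theta> \<longleftrightarrow> carrier B = {\<theta>\<^bsub>B\<^esub>}"
proof
  assume "act_isomorphic S B \<Theta>"
  then obtain u where "bij_betw u (carrier B) {()}"
    by (auto simp: act_isomorphic_def act_iso_def zero_act_def)
  then have inj: "inj_on u (carrier B)" by (rule bij_betw_imp_inj_on)
  have "x = \<theta>\<^bsub>B\<^esub>" if "x \<in> carrier B" for x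
    by (rule inj_onD[OF inj _ that theta_closed[OF assms]]) simp
  then show "carrier B = {\<theta>\<^bsub>B\<^esub>}" using theta_closed[OF assms] by blast
next
  assume "carrier B = {\<theta>\<^bsub>B\<^esub>}"
  then have "(\<lambda>_. ()) \<in> act_iso S B \<Theta>"
    by (auto simp: act_iso_def act_hom_def zero_act_def bij_betw_def)
  then show "act_isomorphic S B \<Theta>" by (auto simp: act_isomorphic_def)
qed

text \<open>The complement of the image is a summand that \<open>A\<close> absorbs, so
  Dedekind-finiteness makes it trivial; nothing is left outside the image.\<close>

lemma dedekind_finite_imp_co_hopfian:
  assumes A: "is_act S A" and tf: "torsion_free S A" and q: "quasi_injective S A"
    and df: "dedekind_finite S A"
  shows "co_hopfian S A"
  unfolding co_hopfian_def
proof (intro ballI impI)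
  fix f assume f: "f \<in> act_hom S A A" and inj: "inj_on f (carrier A)"
  obtain h where h: "h \<in> act_hom S A A" "\<And>a. a \<in> carrier A \<Longrightarrow> h (f a) = a"
    using quasi_injective_left_inverse[OF A q f inj] by blast
  define B where "B = insert \<theta>\<^bsub>A\<^esub> (carrier A - f ` carrier A)"
  have B: "subact S B A"
    unfolding B_def by (rule subact_image_complement[OF A tf f h])
  have D: "is_act S (A\<lparr>carrier := B\<rparr>)" by (rule subact_is_act[OF A B])
  with df act_coprod_image_complement[OF A f inj B_def]
  have "act_isomorphic S (A\<lparr>carrier := B\<rparr>) \<Theta>"
    unfolding dedekind_finite_def by blast
  then have "B = {\<theta>\<^bsub>A\<^esub>}" using act_isomorphic_zero_act_iff[OF D] by simp
  moreover have "\<theta>\<^bsub>A\<^esub> \<in> f ` carrier A"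
    using imageI[OF theta_closed[OF A], of f] by (simp only: act_hom_theta[OF f])
  ultimately have "carrier A \<subseteq> f ` carrier A" unfolding B_def by blast
  then show "f \<in> act_iso S A A"
    using f inj by (auto simp: act_iso_def bij_betw_def act_hom_closed[OF f])
qed

text \<open>An isomorphism from \<open>A \<Coprod> B\<close> to \<open>A\<close>, restricted to the
  left summand, is an injective endomorphism and hence already onto. Injectivity then leaves no room
  for nonzero elements of \<open>B\<close>.\<close>

lemma co_hopfian_imp_dedekind_finite:
  fixes A :: "('a, 's) sact"
  assumes "co_hopfian S A"
  shows "dedekind_finite S A"
  unfolding dedekind_finite_def
proof (intro allI impI, elim conjE)
  fix B :: "('a, 's) sact"
  assume B: "is_act S B" and "act_isomorphic S (A \<Coprod> B) A"
  then obtain p where p: "p \<in> act_hom S (A \<Coprod> B) A" and inj: "inj_on p (carrier (A \<Coprod> B))"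
    by (auto simp: act_isomorphic_def act_iso_def bij_betw_def)
  have "Inl \<in> act_hom S A (A \<Coprod> B)" by (auto simp: act_hom_def act_coprod_def)
  then have "(\<lambda>a. p (Inl a)) \<in> act_hom S A A" by (rule act_hom_comp[OF _ p])
  moreover have "inj_on (\<lambda>a. p (Inl a)) (carrier A)"
    using inj by (auto simp: inj_on_def act_coprod_def)
  ultimately have surj: "(\<lambda>a. p (Inl a)) ` carrier A = carrier A"
    by (rule co_hopfian_surj[OF assms])
  have "b = \<theta>\<^bsub>B\<^esub>" if b: "b \<in> carrier B" for b
  proof -
    have inr: "coprod_inr A B b \<in> carrier (A \<Coprod> B)" using b by (simp add: act_coprod_def)
    then have "p (coprod_inr A B b) \<in> (\<lambda>a. p (Inl a)) ` carrier A"
      unfolding surj by (rule act_hom_closed[OF p])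
    then obtain a where a: "a \<in> carrier A" "p (coprod_inr A B b) = p (Inl a)"
      by (rule imageE)
    moreover have "Inl a \<in> carrier (A \<Coprod> B)" using a by (simp add: act_coprod_def)
    ultimately have "coprod_inr A B b = Inl a" using inr inj_onD[OF inj] by blast
    \<comment> \<open>\<open>coprod_inr\<close> yields a value of the form \<open>Inl a\<close> only
      at the zero of \<open>B\<close>.\<close>
    then show ?thesis by (simp add: coprod_inr_def split: if_splits)
  qed
  then have "carrier B = {\<theta>\<^bsub>B\<^esub>}" using theta_closed[OF B] by blast
  then show "act_isomorphic S B \<Theta>" using act_isomorphic_zero_act_iff[OF B] by simp
qed

section \<open>Mono-uniformity and essential subacts\<close>

lemma mono_uniform_imp_co_hopfian:
  assumes A: "is_act S A" and q: "quasi_injective S A" and mu: "mono_uniform S A"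
  shows "co_hopfian S A"
  unfolding co_hopfian_def
proof (intro ballI impI)
  fix f assume f: "f \<in> act_hom S A A" and inj: "inj_on f (carrier A)"
  obtain h where h: "h \<in> act_hom S A A" and hf: "\<And>a. a \<in> carrier A \<Longrightarrow> h (f a) = a"
    using quasi_injective_left_inverse[OF A q f inj] by blast
  \<comment> \<open>The left inverse \<open>h\<close> is injective on the image of \<open>f\<close>,
    which is essential by mono-uniformity; so \<open>h\<close> is injective on all of
    \<open>A\<close>.\<close>
  have "inj_on h (f ` carrier A)" using hf by (auto simp: inj_on_def)
  then have injh: "inj_on h (carrier A)"
    using mu f inj A h unfolding mono_uniform_def essential_def by blast
  have "a \<in> f ` carrier A" if a: "a \<in> carrier A" for a
  proof -
    have ha: "h a \<in> carrier A" by (rule act_hom_closed[OF h a])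
    \<comment> \<open>Cancel \<open>h\<close> in \<open>h (f (h a)) = h a\<close>: the left inverse
      is also a right inverse.\<close>
    then have "f (h a) = a"
      using hf[OF ha] a injh act_hom_closed[OF f ha] by (metis inj_onD)
    then show ?thesis using ha by (metis imageI)
  qed
  then show "f \<in> act_iso S A A"
    using f inj by (auto simp: act_iso_def bij_betw_def act_hom_closed[OF f])
qed

lemma co_hopfian_imp_essential_image:
  fixes A :: "('a, 's) sact"
  assumes ch: "co_hopfian S A" and f: "f \<in> act_hom S A A" and inj: "inj_on f (carrier A)"
    and ess: "essential S B A"
  shows "essential S (f ` B) A"
  unfolding essential_def
proof (intro conjI allI impI ballI)
  have B: "subact S B A" using ess by (simp add: essential_def)
  show "subact S (f ` B) A" by (rule subact_image[OF f B])
  fix C :: "('a, 's) sact" and g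
  assume C: "is_act S C" and g: "g \<in> act_hom S A C" and gi: "inj_on g (f ` B)"
  have "inj_on f B" using inj B by (auto simp: subact_def intro: inj_on_subset)
  then have "inj_on (\<lambda>x. g (f x)) B" using comp_inj_on[OF _ gi] by (simp add: comp_def)
  then have "inj_on (\<lambda>x. g (f x)) (carrier A)"
    using ess C act_hom_comp[OF f g] unfolding essential_def by blast
  then have "inj_on g (f ` carrier A)" by (auto simp: inj_on_def)
  then show "inj_on g (carrier A)" using co_hopfian_surj[OF ch f inj] by simp
qed

text \<open>An injective endomorphism of \<open>B\<close> extends to an endomorphism
  \<open>h\<close> of \<open>A\<close>, which is injective because \<open>B\<close> is essential and
  therefore an automorphism. Full invariance applied to the inverse of \<open>h\<close> keeps
  preimages of elements of \<open>B\<close> inside \<open>B\<close>.\<close>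

lemma co_hopfian_essential_fully_invariant:
  assumes A: "is_act S A" and q: "quasi_injective S A" and ch: "co_hopfian S A"
    and ess: "essential S B A" and fi: "fully_invariant S B A"
  shows "co_hopfian S (A\<lparr>carrier := B\<rparr>)"
  unfolding co_hopfian_def
proof (intro ballI impI)
  let ?D = "A\<lparr>carrier := B\<rparr>"
  fix f assume f: "f \<in> act_hom S ?D ?D" and inj: "inj_on f (carrier ?D)"
  have B: "subact S B A" using ess by (simp add: essential_def)
  then have BA: "B \<subseteq> carrier A" by (simp add: subact_def)
  have "f \<in> act_hom S ?D A" using f BA by (auto simp: act_hom_def)
  then obtain h where h: "h \<in> act_hom S A A" and hf: "\<And>b. b \<in> B \<Longrightarrow> h b = f b"
    using q B unfolding quasi_injective_def by blast
  have "inj_on h B" using inj hf by (simp add: inj_on_def)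
  then have injh: "inj_on h (carrier A)" using ess A h unfolding essential_def by blast
  have surj: "h ` carrier A = carrier A" by (rule co_hopfian_surj[OF ch h injh])
  \<comment> \<open>The inverse is a homomorphism on the image act of \<open>h\<close>; as
    \<open>h\<close> is onto, that act is \<open>A\<close> itself.\<close>
  have "inv_into (carrier A) h \<in> act_hom S A A"
    using inv_into_act_hom[OF A h injh] by (simp add: surj)
  then have invB: "inv_into (carrier A) h ` B \<subseteq> B" using fi by (simp add: fully_invariant_def)
  have "b \<in> f ` B" if b: "b \<in> B" for b
  proof -
    have "inv_into (carrier A) h b \<in> B" using b invB by blast
    moreover have "h (inv_into (carrier A) h b) = b"
      using b BA surj f_inv_into_f[of b h "carrier A"] by blast
    ultimately show ?thesis using hf by (metis imageI)
  qed
  moreover have "f ` B \<subseteq> B" using f by (auto simp: act_hom_def)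
  ultimately show "f \<in> act_iso S ?D ?D"
    using f inj by (auto simp: act_iso_def bij_betw_def)
qed

theorem corollary2p25:
  fixes S :: "('s, 'm) monoid_scheme" and A :: "('a, 's) sact"
  assumes "monoid S"
    and "is_act S A"
    and "torsion_free S A"
    and "quasi_injective S A"
  shows "(dedekind_finite S A \<longleftrightarrow> co_hopfian S A)
    \<and> (co_hopfian S A \<longleftrightarrow> mono_uniform S A)
    \<and> (mono_uniform S A \<longleftrightarrow>
        (\<forall>f \<in> act_hom S A A. inj_on f (carrier A) \<longrightarrow>
           (\<forall>B. essential S B A \<longrightarrow> essential S (f ` B) A)))
    \<and> ((\<forall>f \<in> act_hom S A A. inj_on f (carrier A) \<longrightarrow>
           (\<forall>B. essential S B A \<longrightarrow> essential S (f ` B) A)) \<longleftrightarrow>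
        (\<forall>B. essential S B A \<and> fully_invariant S B A \<longrightarrow> co_hopfian S (A\<lparr>carrier := B\<rparr>)))
    \<and> ((\<forall>B. essential S B A \<and> fully_invariant S B A \<longrightarrow> co_hopfian S (A\<lparr>carrier := B\<rparr>)) \<longleftrightarrow>
        (\<forall>B. essential S B A \<and> fully_invariant S B A \<longrightarrow> dedekind_finite S (A\<lparr>carrier := B\<rparr>)))"
proof -
  let ?iv = "\<forall>f \<in> act_hom S A A. inj_on f (carrier A) \<longrightarrow>
    (\<forall>B. essential S B A \<longrightarrow> essential S (f ` B) A)"
  let ?v = "\<forall>B. essential S B A \<and> fully_invariant S B A \<longrightarrow> co_hopfian S (A\<lparr>carrier := B\<rparr>)"
  let ?vi = "\<forall>B. essential S B A \<and> fully_invariant S B A \<longrightarrow> dedekind_finite S (A\<lparr>carrier := B\<rparr>)"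
  note A = assms(2) and tf = assms(3) and q = assms(4)
  \<comment> \<open>Two cycles through co-Hopficity suffice: (ii), (iv), (iii), (ii) and (ii), (v),
    (vi), (i), (ii).\<close>
  have i_ii: "dedekind_finite S A \<Longrightarrow> co_hopfian S A"
    by (rule dedekind_finite_imp_co_hopfian[OF A tf q])
  have ii_iv: "co_hopfian S A \<Longrightarrow> ?iv"
    by (blast intro: co_hopfian_imp_essential_image)
  \<comment> \<open>Mono-uniformity is the instance \<open>B = carrier A\<close> of (iv), as
    \<open>A\<close> is essential in itself.\<close>
  have iv_iii: "?iv \<Longrightarrow> mono_uniform S A"
    using essential_carrier[OF A] by (auto simp: mono_uniform_def)
  have iii_ii: "mono_uniform S A \<Longrightarrow> co_hopfian S A"
    by (rule mono_uniform_imp_co_hopfian[OF A q])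
  have ii_v: "co_hopfian S A \<Longrightarrow> ?v"
    by (blast intro: co_hopfian_essential_fully_invariant[OF A q])
  have v_vi: "?v \<Longrightarrow> ?vi"
    by (blast intro: co_hopfian_imp_dedekind_finite)
  \<comment> \<open>\<open>A\<close> is an essential fully invariant subact of itself, and replacing
    its carrier by \<open>carrier A\<close> returns \<open>A\<close>.\<close>
  have vi_i: "?vi \<Longrightarrow> dedekind_finite S A"
    by (drule spec[of _ "carrier A"])
      (simp add: essential_carrier[OF A] fully_invariant_carrier[OF A])
  have v_ii: "?v \<Longrightarrow> co_hopfian S A"
    by (rule i_ii[OF vi_i[OF v_vi]])
  have iv_ii: "?iv \<Longrightarrow> co_hopfian S A"
    by (rule iii_ii[OF iv_iii])
  show ?thesis
  proof (intro conjI)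
    show "dedekind_finite S A \<longleftrightarrow> co_hopfian S A"
      by (rule iffI[OF i_ii vi_i[OF v_vi[OF ii_v]]])
    show "co_hopfian S A \<longleftrightarrow> mono_uniform S A"
      by (rule iffI[OF iv_iii[OF ii_iv] iii_ii])
    show "mono_uniform S A \<longleftrightarrow> ?iv"
      by (rule iffI[OF ii_iv[OF iii_ii] iv_iii])
    show "?iv \<longleftrightarrow> ?v"
      by (rule iffI[OF ii_v[OF iv_ii] ii_iv[OF v_ii]])
    show "?v \<longleftrightarrow> ?vi"
      by (rule iffI[OF v_vi ii_v[OF i_ii[OF vi_i]]])
  qed
qed

end
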